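(* Let $\Gamma$ be a finite group and let $\mathrm{Cay}(\Gamma,S)$ be a normal mixed Cayley graph. Then $\mathrm{Cay}(\Gamma,S)$ is Eisenstein integral if and only if it is HS-integral.
   Context: Let $\Gamma$ be a finite group with identity $\mathbf 1$ and $S\subseteq\Gamma$ with $\mathbf 1\notin S$. The mixed Cayley graph $G=\mathrm{Cay}(\Gamma,S)$ has vertex set $\Gamma$ and edge set $E=\{(a,b): a,b\in\Gamma,\ ba^{-1}\in S\}$ (a set of ordered pairs). It is called normal if $S$ is a union of conjugacy classes of $\Gamma$. The $(0,1)$-adjacency matrix $\mathcal A(G)=(a_{uv})$ has $a_{uv}=1$ if $(u,v)\in E$ and $a_{uv}=0$ otherwise. The Hermitian-adjacency matrix of the second kind $\mathcal H(G)=(h_{uv})$ has $h_{uv}=1$ if $(u,v)\in E$ and $(v,u)\in E$; $h_{uv}=\frac{1+i\sqrt3}{2}$ if $(u,v)\in E$ and $(v,u)\notin E$; $h_{uv}=\frac{1-i\sqrt3}{2}$ if $(u,v)\notin E$ and $(v,u)\in E$; and $h_{uv}=0$ otherwise. $G$ is HS-integral if all eigenvalues of $\mathcal H(G)$ are integers. $G$ is Eisenstein integral if all eigenvalues of $\mathcal A(G)$ are Eisenstein integers, i.e. of the form $a+b\omega_3$ with $a,b\in\mathbb Z$, where $\omega_3=\exp(2\pi i/3)$. *)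

theory Defs
  imports
    Complex_Main
    "HOL-Algebra.Group_Action"
    "Graph_Theory.Pair_Digraph"
    "Jordan_Normal_Form.Char_Poly"
begin

text \<open>
  A mixed graph is a digraph without loops or parallel arcs; an undirected edge is a pair of
  opposite arcs.
\<close>

definition Cay :: "('a, 'b) monoid_scheme \<Rightarrow> 'a set \<Rightarrow> 'a pair_pre_digraph" where
  "Cay \<Gamma> S = \<lparr> pverts = carrier \<Gamma>,
               parcs = {(a, b). a \<in> carrier \<Gamma> \<and> b \<in> carrier \<Gamma> \<and> b \<otimes>\<^bsub>\<Gamma>\<^esub> inv\<^bsub>\<Gamma>\<^esub> a \<in> S} \<rparr>"

definition conjugacy_classes :: "('a, 'b) monoid_scheme \<Rightarrow> 'a set set" where
  "conjugacy_classes \<Gamma> =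
     orbits \<Gamma> (carrier \<Gamma>) (\<lambda>g. \<lambda>h \<in> carrier \<Gamma>. g \<otimes>\<^bsub>\<Gamma>\<^esub> h \<otimes>\<^bsub>\<Gamma>\<^esub> inv\<^bsub>\<Gamma>\<^esub> g)"

definition normal_connection_set :: "('a, 'b) monoid_scheme \<Rightarrow> 'a set \<Rightarrow> bool" where
  "normal_connection_set \<Gamma> S \<longleftrightarrow> (\<exists>\<C> \<subseteq> conjugacy_classes \<Gamma>. S = \<Union>\<C>)"

definition adj_entry :: "'a pair_pre_digraph \<Rightarrow> 'a \<Rightarrow> 'a \<Rightarrow> complex" where
  "adj_entry G u v = (if (u, v) \<in> parcs G then 1 else 0)"

definition herm_entry :: "'a pair_pre_digraph \<Rightarrow> 'a \<Rightarrow> 'a \<Rightarrow> complex" where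
  "herm_entry G u v =
     (if (u, v) \<in> parcs G \<and> (v, u) \<in> parcs G then 1
      else if (u, v) \<in> parcs G \<and> (v, u) \<notin> parcs G then (1 + \<i> * of_real (sqrt 3)) / 2
      else if (u, v) \<notin> parcs G \<and> (v, u) \<in> parcs G then (1 - \<i> * of_real (sqrt 3)) / 2
      else 0)"

text \<open>
  The matrix type is indexed by natural numbers, so a matrix indexed by vertices is written down
  with respect to a list enumerating the vertices. The eigenvalues do not depend on that list,
  see \<open>eigenvalue_vertex_mat_iff\<close> and \<open>eigenvalue_vertex_mat_cong\<close> below.
\<close>

definition vertex_mat :: "'a list \<Rightarrow> ('a \<Rightarrow> 'a \<Rightarrow> complex) \<Rightarrow> complex mat" where
  "vertex_mat vs f = mat (length vs) (length vs) (\<lambda>(i, j). f (vs ! i) (vs ! j))"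

definition vertex_enum :: "'a pair_pre_digraph \<Rightarrow> 'a list \<Rightarrow> bool" where
  "vertex_enum G vs \<longleftrightarrow> distinct vs \<and> set vs = pverts G"

definition adjacency_mat :: "'a pair_pre_digraph \<Rightarrow> 'a list \<Rightarrow> complex mat" where
  "adjacency_mat G vs = vertex_mat vs (adj_entry G)"

definition hermitian_adjacency_mat :: "'a pair_pre_digraph \<Rightarrow> 'a list \<Rightarrow> complex mat" where
  "hermitian_adjacency_mat G vs = vertex_mat vs (herm_entry G)"

definition \<omega>\<^sub>3 :: complex where
  "\<omega>\<^sub>3 = exp (2 * of_real pi * \<i> / 3)"

definition eisenstein_integers :: "complex set" where
  "eisenstein_integers = {of_int a + of_int b * \<omega>\<^sub>3 | a b. True}"

definition HS_integral :: "'a pair_pre_digraph \<Rightarrow> bool" where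
  "HS_integral G \<longleftrightarrow>
     (\<forall>vs. vertex_enum G vs \<longrightarrow> (\<forall>k. eigenvalue (hermitian_adjacency_mat G vs) k \<longrightarrow> k \<in> \<int>))"

definition eisenstein_integral :: "'a pair_pre_digraph \<Rightarrow> bool" where
  "eisenstein_integral G \<longleftrightarrow>
     (\<forall>vs. vertex_enum G vs \<longrightarrow> (\<forall>k. eigenvalue (adjacency_mat G vs) k \<longrightarrow> k \<in> eisenstein_integers))"

lemma ex_vertex_enum: "finite (pverts G) \<Longrightarrow> \<exists>vs. vertex_enum G vs"
  unfolding vertex_enum_def using finite_distinct_list by metis

lemma eigenvalue_vertex_mat_iff:
  assumes "distinct vs"
  shows "eigenvalue (vertex_mat vs f) k \<longleftrightarrow>
    (\<exists>x. (\<exists>v \<in> set vs. x v \<noteq> 0) \<and> (\<forall>u \<in> set vs. (\<Sum>v\<in>set vs. f u v * x v) = k * x u))"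
    (is "?L \<longleftrightarrow> ?R")
proof -
  let ?n = "length vs"
  have sum_vs: "(\<Sum>v\<in>set vs. g v) = (\<Sum>j<?n. g (vs ! j))" for g :: "'a \<Rightarrow> complex"
    by (rule sum.reindex_bij_betw[OF bij_betw_nth, symmetric])
       (use assms in auto)
  have dim: "dim_row (vertex_mat vs f) = ?n"
    by (simp add: vertex_mat_def)
  have ev: "eigenvector (vertex_mat vs f) y k \<longleftrightarrow>
      y \<in> carrier_vec ?n \<and> (\<exists>i<?n. y $ i \<noteq> 0) \<and>
      (\<forall>i<?n. (\<Sum>j<?n. f (vs ! i) (vs ! j) * y $ j) = k * y $ i)" for y
  proof (cases "y \<in> carrier_vec ?n")
    case True
    then have dy: "dim_vec y = ?n" by simp
    have "y = 0\<^sub>v ?n \<longleftrightarrow> (\<forall>i<?n. y $ i = 0)"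
      using dy by (auto intro!: eq_vecI)
    moreover have entry: "(vertex_mat vs f *\<^sub>v y) $ i = (\<Sum>j<?n. f (vs ! i) (vs ! j) * y $ j)"
      if "i < ?n" for i
      using that dy by (simp add: vertex_mat_def scalar_prod_def lessThan_atLeast0)
    have "vertex_mat vs f *\<^sub>v y = k \<cdot>\<^sub>v y \<longleftrightarrow>
        (\<forall>i<?n. (vertex_mat vs f *\<^sub>v y) $ i = (k \<cdot>\<^sub>v y) $ i)"
      using dy dim by (metis dim_mult_mat_vec eq_vecI index_smult_vec(2))
    moreover have "\<dots> \<longleftrightarrow> (\<forall>i<?n. (\<Sum>j<?n. f (vs ! i) (vs ! j) * y $ j) = k * y $ i)"
      using entry dy by simp
    ultimately show ?thesis
      unfolding eigenvector_def dim using True by blast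
  next
    case False
    then show ?thesis unfolding eigenvector_def dim by blast
  qed
  show ?thesis
  proof
    assume ?L
    then obtain y where y: "y \<in> carrier_vec ?n" "\<exists>i<?n. y $ i \<noteq> 0"
      "\<forall>i<?n. (\<Sum>j<?n. f (vs ! i) (vs ! j) * y $ j) = k * y $ i"
      unfolding eigenvalue_def ev by blast
    define x where "x v = y $ (THE i. i < ?n \<and> vs ! i = v)" for v
    have x: "x (vs ! i) = y $ i" if "i < ?n" for i
    proof -
      have "(THE j. j < ?n \<and> vs ! j = vs ! i) = i"
        using assms that by (intro the_equality) (auto simp: nth_eq_iff_index_eq)
      then show ?thesis by (simp add: x_def)
    qed
    have "\<exists>v \<in> set vs. x v \<noteq> 0"
      using y(2) x by (metis nth_mem)
    moreover have "(\<Sum>v\<in>set vs. f u v * x v) = k * x u" if "u \<in> set vs" for u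
      using that y(3) x by (auto simp: in_set_conv_nth sum_vs)
    ultimately show ?R by blast
  next
    assume ?R
    then obtain x where x: "\<exists>v \<in> set vs. x v \<noteq> 0"
      "\<forall>u \<in> set vs. (\<Sum>v\<in>set vs. f u v * x v) = k * x u" by blast
    let ?y = "vec ?n (\<lambda>i. x (vs ! i))"
    obtain i where "i < ?n" "x (vs ! i) \<noteq> 0"
      using x(1) by (metis in_set_conv_nth)
    then have "\<exists>i<?n. ?y $ i \<noteq> 0"
      by (intro exI[of _ i]) simp
    moreover have "(\<Sum>j<?n. f (vs ! i) (vs ! j) * ?y $ j) = k * ?y $ i" if "i < ?n" for i
      using x(2)[rule_format, OF nth_mem[OF that]] that by (simp add: sum_vs)
    ultimately have "eigenvector (vertex_mat vs f) ?y k"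
      unfolding ev by simp
    then show ?L unfolding eigenvalue_def by blast
  qed
qed

lemma eigenvalue_vertex_mat_cong:
  assumes "vertex_enum G vs" "vertex_enum G ws"
  shows "eigenvalue (vertex_mat vs f) k \<longleftrightarrow> eigenvalue (vertex_mat ws f) k"
  using assms by (simp add: vertex_enum_def eigenvalue_vertex_mat_iff)

end

theory Submission
  imports Defs
begin

text \<open>
  Write \<open>A\<close> for the adjacency matrix and \<open>\<zeta> = (1 + \<i> \<surd>3) / 2\<close>. Since \<open>\<zeta> + cnj \<zeta> = 1\<close>, the Hermitian
  matrix is \<open>H = \<zeta> A + cnj \<zeta> A\<^sup>T\<close>. Normality of the Cayley graph makes \<open>A\<close> a normal matrix, so the
  eigenvalues of \<open>H\<close> are the numbers \<open>2 Re (\<zeta> \<lambda>)\<close> with \<open>\<lambda>\<close> an eigenvalue of \<open>A\<close>; they are integers if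
  \<open>\<lambda>\<close> is an Eisenstein integer. Conversely, suppose \<open>m = 2 Re (\<zeta> \<lambda>)\<close> and \<open>l = 2 Re (\<zeta> cnj \<lambda>)\<close> are
  integers. Then \<open>3 |\<lambda>|\<^sup>2 = m\<^sup>2 + m l + l\<^sup>2\<close>, so \<open>|\<lambda>|\<^sup>2\<close> is rational, and it is an eigenvalue of the
  integer matrix \<open>A A\<^sup>T\<close>, hence an integer. So \<open>3\<close> divides \<open>m - l\<close>, which says that \<open>\<lambda>\<close> is an
  Eisenstein integer.
\<close>

section \<open>Commuting operators on functions over a finite set\<close>

lemma linear_dependence_functions:
  fixes h :: "nat \<Rightarrow> 'a \<Rightarrow> 'b::field"
  assumes "finite V"
  obtains c where "\<exists>k\<le>card V. c k \<noteq> 0" and "\<forall>u\<in>V. (\<Sum>k\<le>card V. c k * h k u) = 0"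
proof -
  obtain vs where vs: "set vs = V" "distinct vs"
    using finite_distinct_list[OF assms] by blast
  define n where "n = card V"
  have len: "length vs = n"
    using vs distinct_card n_def by metis
  \<comment> \<open>The first \<open>n\<close> rows hold the values of the \<open>n + 1\<close>
    functions; the zero row makes the matrix square and singular, so a kernel vector supplies the
    coefficients.\<close>
  define r where "r i = (if i = n then 0\<^sub>v (Suc n) else vec (Suc n) (\<lambda>k. h k (vs ! i)))" for i
  define K where "K = mat\<^sub>r (Suc n) (Suc n) r"
  have K: "K \<in> carrier_mat (Suc n) (Suc n)"
    by (simp add: K_def)
  have "det K = 0"
    unfolding K_def r_def by (rule det_row_0) auto
  then obtain w where w: "w \<in> carrier_vec (Suc n)" "w \<noteq> 0\<^sub>v (Suc n)" "K *\<^sub>v w = 0\<^sub>v (Suc n)"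
    using det_0_iff_vec_prod_zero_field[OF K] by blast
  show ?thesis
  proof (rule that)
    show "\<exists>k\<le>card V. w $ k \<noteq> 0"
      using w(1,2) unfolding n_def[symmetric]
      by (metis carrier_vecD eq_vecI index_zero_vec less_Suc_eq_le)
    show "\<forall>u\<in>V. (\<Sum>k\<le>card V. w $ k * h k u) = 0"
    proof
      fix u assume "u \<in> V"
      then obtain i where i: "i < n" "vs ! i = u"
        using vs len by (metis in_set_conv_nth)
      have "0 = (K *\<^sub>v w) $ i"
        using w(3) i by simp
      also have "\<dots> = (\<Sum>k<Suc n. h k u * w $ k)"
        using i w(1) K by (simp add: K_def r_def scalar_prod_def lessThan_atLeast0 del: sum.lessThan_Suc sum.op_ivl_Suc)
      finally show "(\<Sum>k\<le>card V. w $ k * h k u) = 0"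
        by (simp add: n_def[symmetric] lessThan_Suc_atMost mult.commute del: sum.lessThan_Suc)
    qed
  qed
qed

text \<open>Matrix-vector product with both factors indexed by vertices, which keeps vertex
  enumerations out of the linear algebra.\<close>

definition apply_on :: "'a set \<Rightarrow> ('a \<Rightarrow> 'a \<Rightarrow> complex) \<Rightarrow> ('a \<Rightarrow> complex) \<Rightarrow> 'a \<Rightarrow> complex" where
  "apply_on V f x u = (\<Sum>v\<in>V. f u v * x v)"

lemma apply_on_sum: "apply_on V f (\<lambda>v. \<Sum>k\<in>K. c k * y k v) u = (\<Sum>k\<in>K. c k * apply_on V f (y k) u)"
  unfolding apply_on_def sum_distrib_left
  by (subst sum.swap) (simp add: mult_ac)

lemma apply_on_scale:
  assumes "\<forall>v\<in>V. z v = a * y v"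
  shows "apply_on V f z u = a * apply_on V f y u"
  using assms by (simp add: apply_on_def sum_distrib_left mult.left_commute)

lemma apply_on_comm:
  assumes "\<forall>u\<in>V. \<forall>w\<in>V. (\<Sum>v\<in>V. f u v * g v w) = (\<Sum>v\<in>V. g u v * f v w)" and "u \<in> V"
  shows "apply_on V f (apply_on V g x) u = apply_on V g (apply_on V f x) u"
proof -
  have swap: "apply_on V f (apply_on V g x) u = (\<Sum>w\<in>V. (\<Sum>v\<in>V. f u v * g v w) * x w)" for f g
    unfolding apply_on_def sum_distrib_left sum_distrib_right
    by (subst sum.swap) (simp add: mult_ac)
  show ?thesis
    using assms by (simp add: swap)
qed

text \<open>This is \<open>p\<close> evaluated at the operator \<open>apply_on V f\<close>, applied
  to \<open>x\<close>.\<close>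

definition krylov :: "'a set \<Rightarrow> ('a \<Rightarrow> 'a \<Rightarrow> complex) \<Rightarrow> ('a \<Rightarrow> complex) \<Rightarrow> complex poly \<Rightarrow> 'a \<Rightarrow> complex" where
  "krylov V f x p u = (\<Sum>k\<le>degree p. coeff p k * (apply_on V f ^^ k) x u)"

lemma krylov_le:
  assumes "degree p \<le> N"
  shows "krylov V f x p u = (\<Sum>k\<le>N. coeff p k * (apply_on V f ^^ k) x u)"
  unfolding krylov_def using assms
  by (intro sum.mono_neutral_left) (auto simp: coeff_eq_0)

text \<open>Serves to split off an eigenfunction: if (X - a) q annihilates \<open>x\<close>, then
  \<open>f\<close> acts on q(f) x as the scalar \<open>a\<close>.\<close>

lemma krylov_linear_factor:
  "krylov V f x ([:-a, 1:] * q) u = apply_on V f (krylov V f x q) u - a * krylov V f x q u"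
proof -
  let ?N = "degree q" and ?T = "\<lambda>k. (apply_on V f ^^ k) x"
  have "degree ([:-a, 1:] * q) \<le> Suc ?N"
    by (rule order_trans[OF degree_mult_le]) simp
  then have "krylov V f x ([:-a, 1:] * q) u = (\<Sum>k\<le>Suc ?N. coeff ([:-a, 1:] * q) k * ?T k u)"
    by (rule krylov_le)
  also have "\<dots> = (\<Sum>k\<le>Suc ?N. coeff (pCons 0 q) k * ?T k u) - a * (\<Sum>k\<le>Suc ?N. coeff q k * ?T k u)"
    by (simp add: sum_distrib_left sum_subtractf algebra_simps del: sum.atMost_Suc)
  also have "(\<Sum>k\<le>Suc ?N. coeff q k * ?T k u) = krylov V f x q u"
    by (rule krylov_le[symmetric]) simp
  \<comment> \<open>\<open>pCons 0 q\<close> is X q: shifting the coefficients by one costs one more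
    application of \<open>f\<close>.\<close>
  also have "(\<Sum>k\<le>Suc ?N. coeff (pCons 0 q) k * ?T k u) = (\<Sum>k\<le>?N. coeff q k * ?T (Suc k) u)"
    by (subst sum.atMost_Suc_shift) simp
  also have "\<dots> = apply_on V f (\<lambda>v. \<Sum>k\<le>?N. coeff q k * ?T k v) u"
    by (simp add: apply_on_sum)
  also have "(\<lambda>v. \<Sum>k\<le>?N. coeff q k * ?T k v) = krylov V f x q"
    by (simp add: krylov_def fun_eq_iff)
  finally show ?thesis .
qed

text \<open>Since \<open>f\<close> and \<open>g\<close> commute, every iterate of \<open>f\<close>
  on \<open>x\<close> stays in the \<mu>-eigenspace of \<open>g\<close>. Take a nonzero polynomial
  \<open>p0\<close> of least degree with p0(f) x = 0 and split off a root, p0 = (X - a) q. Then q(f)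
  x is nonzero by minimality, and \<open>f\<close> acts on it as \<open>a\<close>.\<close>

lemma common_eigenfunction:
  assumes fin: "finite V"
    and comm: "\<forall>u\<in>V. \<forall>w\<in>V. (\<Sum>v\<in>V. f u v * g v w) = (\<Sum>v\<in>V. g u v * f v w)"
    and nz: "\<exists>v\<in>V. x v \<noteq> 0"
    and ev: "\<forall>u\<in>V. apply_on V g x u = \<mu> * x u"
  obtains y a where "\<exists>v\<in>V. y v \<noteq> 0"
    and "\<forall>u\<in>V. apply_on V g y u = \<mu> * y u" and "\<forall>u\<in>V. apply_on V f y u = a * y u"
proof -
  define P where "P p \<longleftrightarrow> p \<noteq> 0 \<and> (\<forall>u\<in>V. krylov V f x p u = 0)" for p
  obtain c where c: "\<exists>k\<le>card V. c k \<noteq> 0"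
      "\<forall>u\<in>V. (\<Sum>k\<le>card V. c k * (apply_on V f ^^ k) x u) = 0"
    by (rule linear_dependence_functions[OF fin, of "\<lambda>k. (apply_on V f ^^ k) x"])
  \<comment> \<open>The linear dependence among the iterates is read as an annihilating polynomial
    of \<open>x\<close>.\<close>
  define p where "p = (\<Sum>k\<le>card V. monom (c k) k)"
  have coeff_p: "coeff p k = (if k \<le> card V then c k else 0)" for k
    by (simp add: p_def coeff_sum)
  then have "degree p \<le> card V"
    by (intro degree_le) auto
  then have "\<forall>u\<in>V. krylov V f x p u = 0"
    using c(2) coeff_p by (simp add: krylov_le)
  moreover have "p \<noteq> 0"
    using c(1) coeff_p by (metis coeff_0)
  ultimately have "P p"
    by (simp add: P_def)
  define p0 where "p0 = arg_min degree P"
  have p0: "P p0" and p0_min: "\<And>q. P q \<Longrightarrow> degree p0 \<le> degree q"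
    using arg_min_nat_lemma[of P p degree] \<open>P p\<close> unfolding p0_def by auto
  have "degree p0 \<noteq> 0"
  proof
    assume "degree p0 = 0"
    then obtain b where "p0 = [:b:]"
      by (rule degree_eq_zeroE)
    then show False
      using p0 nz by (auto simp: P_def krylov_def)
  qed
  then obtain a where "poly p0 a = 0"
    using fundamental_theorem_of_algebra[of p0] by (auto simp: constant_degree)
  then obtain q where q: "p0 = [:-a, 1:] * q"
    by (metis poly_eq_0_iff_dvd dvdE)
  have "q \<noteq> 0"
    using p0 q by (auto simp: P_def)
  have "degree p0 = Suc (degree q)"
    using \<open>q \<noteq> 0\<close> unfolding q by (subst degree_mult_eq) auto
  then have "\<not> P q"
    using p0_min[of q] by auto
  have power_ev: "\<forall>u\<in>V. apply_on V g ((apply_on V f ^^ k) x) u = \<mu> * (apply_on V f ^^ k) x u" for k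
  proof (induction k)
    case 0
    then show ?case using ev by simp
  next
    case (Suc k)
    let ?y = "(apply_on V f ^^ k) x"
    show ?case
    proof
      fix u assume u: "u \<in> V"
      have "apply_on V g (apply_on V f ?y) u = apply_on V f (apply_on V g ?y) u"
        using apply_on_comm[OF comm u] by simp
      also have "\<dots> = \<mu> * apply_on V f ?y u"
        using Suc by (rule apply_on_scale)
      finally show "apply_on V g ((apply_on V f ^^ Suc k) x) u = \<mu> * (apply_on V f ^^ Suc k) x u"
        by simp
    qed
  qed
  show ?thesis
  proof (rule that)
    show "\<exists>v\<in>V. krylov V f x q v \<noteq> 0"
      using \<open>\<not> P q\<close> \<open>q \<noteq> 0\<close> by (auto simp: P_def)
    show "\<forall>u\<in>V. apply_on V f (krylov V f x q) u = a * krylov V f x q u"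
      using p0 krylov_linear_factor[of V f x a q] by (simp add: P_def q)
    have "krylov V f x q = (\<lambda>v. \<Sum>k\<le>degree q. coeff q k * (apply_on V f ^^ k) x v)"
      by (simp add: krylov_def fun_eq_iff)
    then show "\<forall>u\<in>V. apply_on V g (krylov V f x q) u = \<mu> * krylov V f x q u"
      using power_ev by (simp add: apply_on_sum sum_distrib_left mult.left_commute)
  qed
qed

text \<open>As \<open>f\<close> is real, its transpose is its adjoint. Computing the inner product
  of f y with \<open>y\<close> on either side gives a N = cnj b N, where N > 0 is the squared norm
  of \<open>y\<close>.\<close>

lemma transpose_eigenvalue_cnj:
  assumes fin: "finite V" and real: "\<And>u v. cnj (f u v) = f u v"
    and nz: "\<exists>v\<in>V. y v \<noteq> 0"
    and ev: "\<forall>u\<in>V. apply_on V f y u = a * y u"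
    and ev': "\<forall>u\<in>V. apply_on V (\<lambda>u v. f v u) y u = b * y u"
  shows "b = cnj a"
proof -
  define N where "N = (\<Sum>u\<in>V. y u * cnj (y u))"
  have "N = of_real (\<Sum>u\<in>V. (cmod (y u))\<^sup>2)"
    unfolding N_def of_real_sum complex_norm_square ..
  moreover have "(\<Sum>u\<in>V. (cmod (y u))\<^sup>2) > 0"
    using fin nz by (auto intro: sum_pos2)
  ultimately have "N \<noteq> 0"
    by (metis less_irrefl of_real_eq_0_iff)
  have "cnj b * N = (\<Sum>v\<in>V. y v * cnj (b * y v))"
    by (simp add: N_def sum_distrib_left mult_ac)
  also have "\<dots> = (\<Sum>v\<in>V. y v * cnj (apply_on V (\<lambda>u v. f v u) y v))"
    using ev' by simp
  also have "\<dots> = (\<Sum>v\<in>V. \<Sum>u\<in>V. y v * (f u v * cnj (y u)))"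
    by (simp add: apply_on_def real sum_distrib_left)
  also have "\<dots> = (\<Sum>u\<in>V. apply_on V f y u * cnj (y u))"
    by (subst sum.swap) (simp add: apply_on_def sum_distrib_left mult_ac)
  also have "\<dots> = a * N"
    using ev by (simp add: N_def sum_distrib_left mult_ac)
  finally have "cnj b = a"
    using \<open>N \<noteq> 0\<close> by simp
  then show ?thesis by auto
qed

text \<open>The characteristic polynomial of an integer matrix is monic with integer
  coefficients.\<close>

lemma algebraic_int_eigenvalue:
  fixes M :: "int mat" and k :: "'a::field_char_0"
  assumes M: "M \<in> carrier_mat n n" and ev: "eigenvalue (map_mat of_int M) k"
  shows "algebraic_int k"
proof -
  have "poly (char_poly (map_mat of_int M)) k = 0"
    using ev M eigenvalue_root_char_poly[of "map_mat of_int M" n k] by simp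
  then have "poly (map_poly of_int (char_poly M)) k = 0"
    by (simp add: of_int_hom.char_poly_hom[OF M])
  moreover have "lead_coeff (char_poly M) = 1"
    using degree_monic_char_poly[OF M] by auto
  ultimately show ?thesis
    using algebraic_int_altdef_ipoly by blast
qed

section \<open>Sixth roots of unity and Eisenstein integers\<close>

definition \<zeta>\<^sub>6 :: complex where "\<zeta>\<^sub>6 = (1 + \<i> * of_real (sqrt 3)) / 2"

lemma herm_entry_eq: "herm_entry G u v = \<zeta>\<^sub>6 * adj_entry G u v + cnj \<zeta>\<^sub>6 * adj_entry G v u"
  by (simp add: herm_entry_def adj_entry_def \<zeta>\<^sub>6_def complex_eq_iff)

lemma \<omega>\<^sub>3_eq: "\<omega>\<^sub>3 = (- 1 + \<i> * of_real (sqrt 3)) / 2"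
proof -
  have "\<omega>\<^sub>3 = cis (2 * pi / 3)"
    by (simp add: \<omega>\<^sub>3_def cis_conv_exp mult_ac)
  then show ?thesis
    by (simp add: complex_eq_iff cos_120 sin_120)
qed

text \<open>For z = a + b \<omega> with \<omega> = \<open>\<omega>\<^sub>3\<close>, the sum is Re z
  - sqrt 3 Im z = a - 2 b.\<close>

lemma eisenstein_imp_int:
  assumes "z \<in> eisenstein_integers"
  shows "\<zeta>\<^sub>6 * z + cnj \<zeta>\<^sub>6 * cnj z \<in> \<int>"
proof -
  obtain a b where "z = of_int a + of_int b * \<omega>\<^sub>3"
    using assms by (auto simp: eisenstein_integers_def)
  then have re: "Re z = of_int a - of_int b / 2" and im: "Im z = sqrt 3 * (of_int b / 2)"
    by (simp_all add: \<omega>\<^sub>3_eq)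
  have "sqrt 3 * Im z = 3 * of_int b / 2"
    unfolding im by simp
  with re have "Re z - sqrt 3 * Im z = of_int (a - 2 * b)"
    by simp
  moreover have "\<zeta>\<^sub>6 * z + cnj \<zeta>\<^sub>6 * cnj z = of_real (Re z - sqrt 3 * Im z)"
    by (simp add: \<zeta>\<^sub>6_def complex_eq_iff field_simps)
  ultimately have "\<zeta>\<^sub>6 * z + cnj \<zeta>\<^sub>6 * cnj z = of_int (a - 2 * b)"
    by (metis of_real_of_int_eq)
  then show ?thesis
    by (metis Ints_of_int)
qed

text \<open>The points with integral \<open>m\<close> and \<open>l\<close> form a lattice containing
  the Eisenstein integers with index 3. The latter are singled out by 3 dividing l - m, which the
  integrality of the squared modulus forces.\<close>

lemma int_imp_eisenstein:
  assumes m: "\<zeta>\<^sub>6 * z + cnj \<zeta>\<^sub>6 * cnj z \<in> \<int>" and l: "\<zeta>\<^sub>6 * cnj z + cnj \<zeta>\<^sub>6 * z \<in> \<int>"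
    and alg: "algebraic_int (z * cnj z)"
  shows "z \<in> eisenstein_integers"
proof -
  obtain m l where m: "\<zeta>\<^sub>6 * z + cnj \<zeta>\<^sub>6 * cnj z = of_int m"
    and l: "\<zeta>\<^sub>6 * cnj z + cnj \<zeta>\<^sub>6 * z = of_int l"
    using m l by (auto elim!: Ints_cases)
  have re: "Re z - sqrt 3 * Im z = of_int m" "Re z + sqrt 3 * Im z = of_int l"
    using m l by (simp_all add: \<zeta>\<^sub>6_def complex_eq_iff field_simps)
  \<comment> \<open>With x = Re z and t = sqrt 3 Im z, the right side is (x - t)^2 + (x - t)(x + t)
    + (x + t)^2 = 3 x^2 + t^2.\<close>
  have "3 * ((Re z)\<^sup>2 + (Im z)\<^sup>2) = of_int (m\<^sup>2 + m * l + l\<^sup>2)"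
    unfolding of_int_add of_int_mult of_int_power re[symmetric]
    by (simp add: power2_eq_square algebra_simps)
  then have norm: "z * cnj z = of_int (m\<^sup>2 + m * l + l\<^sup>2) / 3"
    by (simp add: complex_mult_cnj complex_eq_iff)
  have "z * cnj z \<in> \<rat>"
    unfolding norm by (intro Rats_divide) auto
  then have "z * cnj z \<in> \<int>"
    using alg rational_algebraic_int_is_int by blast
  then obtain N where "z * cnj z = of_int N"
    by (auto elim: Ints_cases)
  then have "of_int (m\<^sup>2 + m * l + l\<^sup>2) = (of_int (3 * N) :: complex)"
    using norm by (simp add: field_simps)
  then have "m\<^sup>2 + m * l + l\<^sup>2 = 3 * N"
    using of_int_eq_iff by blast
  \<comment> \<open>Subtracting 3 m l turns the quadratic form into a square.\<close>
  then have "(l - m) ^ 2 = 3 * (N - m * l)"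
    by (simp add: power2_eq_square algebra_simps)
  then have "3 dvd (l - m) ^ 2"
    by simp
  then have "3 dvd l - m"
    using prime_dvd_power[of "3 :: int"] by simp
  \<comment> \<open>Here l - m = 2 sqrt 3 Im z, and \<open>\<omega>\<^sub>3\<close> has imaginary
    part sqrt 3 / 2, so \<open>b\<close> is the coefficient of
    \<open>\<omega>\<^sub>3\<close>.\<close>
  then obtain b where b: "l = m + 3 * b"
    by (metis dvdE add.commute diff_add_cancel)
  have "Re z = of_int m + 3 * of_int b / 2"
    using re b by simp
  moreover have "Im z = of_int b * sqrt 3 / 2"
  proof -
    have "3 * Im z = sqrt 3 * (sqrt 3 * Im z)"
      by simp
    also have "sqrt 3 * Im z = 3 * of_int b / 2"
      using re b by simp
    finally show ?thesis
      by simp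
  qed
  ultimately have "z = of_int (m + 2 * b) + of_int b * \<omega>\<^sub>3"
    by (simp add: \<omega>\<^sub>3_eq complex_eq_iff)
  then show ?thesis
    unfolding eisenstein_integers_def by blast
qed

section \<open>Normality of the adjacency matrix of a Cayley graph\<close>

context group
begin

lemma normal_connection_set_conj:
  assumes "normal_connection_set G S" and "s \<in> S" and g: "g \<in> carrier G"
  shows "g \<otimes> s \<otimes> inv g \<in> S"
proof -
  obtain \<C> where \<C>: "\<C> \<subseteq> conjugacy_classes G" "S = \<Union>\<C>"
    using assms(1) unfolding normal_connection_set_def by blast
  then obtain C where C: "C \<in> \<C>" "s \<in> C"
    using assms(2) by blast
  then obtain h where h: "h \<in> carrier G"
      and C_eq: "C = orbit G (\<lambda>g. \<lambda>h\<in>carrier G. g \<otimes> h \<otimes> inv g) h"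
    using \<C>(1) unfolding conjugacy_classes_def orbits_def by blast
  then obtain k where k: "k \<in> carrier G" "s = k \<otimes> h \<otimes> inv k"
    using C(2) by (auto simp: orbit_def)
  have "g \<otimes> s \<otimes> inv g = (g \<otimes> k) \<otimes> h \<otimes> inv (g \<otimes> k)"
    using g k h by (simp add: m_assoc inv_mult_group)
  then have "g \<otimes> s \<otimes> inv g \<in> C"
    using g k h unfolding C_eq orbit_def by (auto intro!: exI[of _ "g \<otimes> k"])
  then show ?thesis
    using \<C>(2) C(1) by blast
qed

text \<open>Conjugating a b by the inverse of \<open>a\<close> gives b a.\<close>

lemma normal_connection_set_commute:
  assumes "normal_connection_set G S" and "a \<in> carrier G" "b \<in> carrier G" and "a \<otimes> b \<in> S"
  shows "b \<otimes> a \<in> S"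
proof -
  have "inv a \<otimes> (a \<otimes> b) \<otimes> inv (inv a) = b \<otimes> a"
    using assms(2,3) by (simp add: m_assoc[symmetric])
  then show ?thesis
    using normal_connection_set_conj[OF assms(1,4), of "inv a"] assms(2) by simp
qed

text \<open>The common out-neighbours \<open>v\<close> of \<open>u\<close> and \<open>w\<close> correspond to their common in-neighbours
  \<open>w v\<^sup>-\<^sup>1 u\<close>.\<close>

lemma Cay_adj_normal:
  assumes normal: "normal_connection_set G S" and u: "u \<in> carrier G" and w: "w \<in> carrier G"
  shows "(\<Sum>v\<in>carrier G. adj_entry (Cay G S) u v * adj_entry (Cay G S) w v) =
         (\<Sum>v\<in>carrier G. adj_entry (Cay G S) v u * adj_entry (Cay G S) v w)"
proof (rule sum.reindex_bij_witness[of _ "\<lambda>v. u \<otimes> inv v \<otimes> w" "\<lambda>v. w \<otimes> inv v \<otimes> u"])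
  fix v assume v: "v \<in> carrier G"
  show "w \<otimes> inv v \<otimes> u \<in> carrier G" "u \<otimes> inv v \<otimes> w \<in> carrier G"
    using u w v by auto
  show "u \<otimes> inv (w \<otimes> inv v \<otimes> u) \<otimes> w = v" "w \<otimes> inv (u \<otimes> inv v \<otimes> w) \<otimes> u = v"
    using u w v by (simp_all add: inv_mult_group m_assoc inv_solve_left)
      (simp_all add: m_assoc[symmetric])
  have 1: "u \<otimes> inv (w \<otimes> inv v \<otimes> u) = v \<otimes> inv w"
    using u w v by (simp add: inv_mult_group m_assoc[symmetric])
  \<comment> \<open>The arc from the new vertex to \<open>w\<close> is labelled by the same two
    factors as the arc from \<open>u\<close> to \<open>v\<close>, in the opposite order; so
    \<open>u\<close> and \<open>w\<close> exchange roles.\<close>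
  have "w \<otimes> inv (w \<otimes> inv v \<otimes> u) = (w \<otimes> inv u) \<otimes> (v \<otimes> inv w)"
    using u w v by (simp add: inv_mult_group m_assoc)
  moreover have "(v \<otimes> inv w) \<otimes> (w \<otimes> inv u) = v \<otimes> inv u"
    using u w v by (simp add: m_assoc inv_solve_left) (simp add: m_assoc[symmetric])
  ultimately have 2: "w \<otimes> inv (w \<otimes> inv v \<otimes> u) \<in> S \<longleftrightarrow> v \<otimes> inv u \<in> S"
    using normal_connection_set_commute[OF normal, of "w \<otimes> inv u" "v \<otimes> inv w"]
      normal_connection_set_commute[OF normal, of "v \<otimes> inv w" "w \<otimes> inv u"] u w v by auto
  show "adj_entry (Cay G S) (w \<otimes> inv v \<otimes> u) u * adj_entry (Cay G S) (w \<otimes> inv v \<otimes> u) w =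
        adj_entry (Cay G S) u v * adj_entry (Cay G S) w v"
    using u w v 1 2 by (simp add: adj_entry_def Cay_def)
qed

end

section \<open>Joint spectrum of a real normal matrix and its transpose\<close>

lemma apply_on_linear_combination:
  "apply_on V (\<lambda>u v. c * f u v + d * g u v) x u = c * apply_on V f x u + d * apply_on V g x u"
  by (simp add: apply_on_def sum_distrib_left sum.distrib algebra_simps)

text \<open>Normality says that \<open>f\<close> commutes with its transpose, so the
  \<open>a\<close>-eigenspace of \<open>f\<close> contains an eigenfunction of the transpose; its
  eigenvalue there is the conjugate of \<open>a\<close>.\<close>

lemma normal_eigenfunction:
  assumes "finite V" and real: "\<And>u v. cnj (f u v) = f u v"
    and normal: "\<forall>u\<in>V. \<forall>w\<in>V. (\<Sum>v\<in>V. f u v * f w v) = (\<Sum>v\<in>V. f v u * f v w)"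
    and "\<exists>v\<in>V. x v \<noteq> 0" and "\<forall>u\<in>V. apply_on V f x u = a * x u"
  obtains y where "\<exists>v\<in>V. y v \<noteq> 0"
    and "\<forall>u\<in>V. apply_on V f y u = a * y u" and "\<forall>u\<in>V. apply_on V (\<lambda>u v. f v u) y u = cnj a * y u"
proof -
  obtain y b where "\<exists>v\<in>V. y v \<noteq> 0"
    and "\<forall>u\<in>V. apply_on V f y u = a * y u" and "\<forall>u\<in>V. apply_on V (\<lambda>u v. f v u) y u = b * y u"
    by (rule common_eigenfunction[where f = "\<lambda>u v. f v u" and g = f])
       (use assms in auto)
  moreover from this have "b = cnj a"
    using transpose_eigenvalue_cnj[of V f y a b, OF assms(1) real] by blast
  ultimately show ?thesis
    using that by blast
qed

text \<open>The combination commutes with \<open>f\<close>, so its \<mu>-eigenspace contains an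
  eigenfunction of \<open>f\<close>. As \<open>d\<close> is nonzero, the transpose acts on it as a
  scalar too, and that scalar must be the conjugate of \<open>a\<close>.\<close>

lemma normal_eigenfunction_of_combination:
  assumes "finite V" and real: "\<And>u v. cnj (f u v) = f u v"
    and normal: "\<forall>u\<in>V. \<forall>w\<in>V. (\<Sum>v\<in>V. f u v * f w v) = (\<Sum>v\<in>V. f v u * f v w)"
    and "\<exists>v\<in>V. x v \<noteq> 0" and "d \<noteq> 0"
    and "\<forall>u\<in>V. apply_on V (\<lambda>u v. c * f u v + d * f v u) x u = \<mu> * x u"
  obtains y a where "\<exists>v\<in>V. y v \<noteq> 0" and "\<forall>u\<in>V. apply_on V f y u = a * y u"
    and "\<mu> = c * a + d * cnj a"
proof -
  have "\<forall>u\<in>V. \<forall>w\<in>V. (\<Sum>v\<in>V. f u v * (c * f v w + d * f w v)) = (\<Sum>v\<in>V. (c * f u v + d * f v u) * f v w)"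
    using normal by (simp add: algebra_simps sum.distrib sum_distrib_left[symmetric])
  then obtain y a where nz: "\<exists>v\<in>V. y v \<noteq> 0"
    and ev: "\<forall>u\<in>V. apply_on V (\<lambda>u v. c * f u v + d * f v u) y u = \<mu> * y u"
    and ev_f: "\<forall>u\<in>V. apply_on V f y u = a * y u"
    using common_eigenfunction[OF assms(1) _ assms(4,6)] by blast
  have ev_t: "\<forall>u\<in>V. apply_on V (\<lambda>u v. f v u) y u = (\<mu> - c * a) / d * y u"
    using ev ev_f \<open>d \<noteq> 0\<close> by (simp add: apply_on_linear_combination field_simps)
  have "(\<mu> - c * a) / d = cnj a"
    using transpose_eigenvalue_cnj[of V f, OF assms(1) real nz ev_f ev_t] .
  then have "\<mu> = c * a + d * cnj a"
    using \<open>d \<noteq> 0\<close> by (simp add: field_simps)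
  then show ?thesis
    using that nz ev_f by blast
qed

section \<open>Transfer of integrality between the two spectra\<close>

theorem theorem5p16:
  fixes \<Gamma> :: "('a, 'b) monoid_scheme" and S :: "'a set"
  assumes "group \<Gamma>" and "finite (carrier \<Gamma>)"
    and "S \<subseteq> carrier \<Gamma>" and "\<one>\<^bsub>\<Gamma>\<^esub> \<notin> S"
    and "normal_connection_set \<Gamma> S"
  shows "eisenstein_integral (Cay \<Gamma> S) \<longleftrightarrow> HS_integral (Cay \<Gamma> S)"
proof -
  let ?G = "Cay \<Gamma> S"
  define V where "V = carrier \<Gamma>"
  define f where "f = adj_entry ?G"
  define h where "h = herm_entry ?G"
  have fin: "finite V"
    using assms(2) by (simp add: V_def)
  have real: "cnj (f u v) = f u v" for u v
    by (simp add: f_def adj_entry_def)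
  have normal: "\<forall>u\<in>V. \<forall>w\<in>V. (\<Sum>v\<in>V. f u v * f w v) = (\<Sum>v\<in>V. f v u * f v w)"
    using group.Cay_adj_normal[OF assms(1,5)] by (simp add: V_def f_def)
  have h: "h = (\<lambda>u v. \<zeta>\<^sub>6 * f u v + cnj \<zeta>\<^sub>6 * f v u)"
    by (simp add: h_def f_def herm_entry_eq fun_eq_iff)
  have \<zeta>_nz: "cnj \<zeta>\<^sub>6 \<noteq> 0"
    by (simp add: \<zeta>\<^sub>6_def complex_eq_iff)
  \<comment> \<open>Rephrases eigenvalues without the enumeration \<open>vs\<close>.\<close>
  have ev_iff: "eigenvalue (vertex_mat vs q) k \<longleftrightarrow>
      (\<exists>x. (\<exists>v\<in>V. x v \<noteq> 0) \<and> (\<forall>u\<in>V. apply_on V q x u = k * x u))" if "vertex_enum ?G vs" for vs q k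
    using that by (simp add: vertex_enum_def eigenvalue_vertex_mat_iff apply_on_def V_def Cay_def)
  show ?thesis
  proof
    assume eis: "eisenstein_integral ?G"
    show "HS_integral ?G"
      unfolding HS_integral_def
    proof (intro allI impI)
      fix vs k assume vs: "vertex_enum ?G vs" and "eigenvalue (hermitian_adjacency_mat ?G vs) k"
      then obtain x where "\<exists>v\<in>V. x v \<noteq> 0" "\<forall>u\<in>V. apply_on V h x u = k * x u"
        unfolding hermitian_adjacency_mat_def h_def[symmetric] ev_iff[OF vs] by blast
      then obtain y a where "\<exists>v\<in>V. y v \<noteq> 0" "\<forall>u\<in>V. apply_on V f y u = a * y u"
        and k: "k = \<zeta>\<^sub>6 * a + cnj \<zeta>\<^sub>6 * cnj a"
        unfolding h using normal_eigenfunction_of_combination[OF fin real normal _ \<zeta>_nz] by blast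
      then have "eigenvalue (adjacency_mat ?G vs) a"
        unfolding adjacency_mat_def f_def[symmetric] ev_iff[OF vs] by blast
      then show "k \<in> \<int>"
        unfolding k using eis vs by (auto simp: eisenstein_integral_def intro: eisenstein_imp_int)
    qed
  next
    assume hs: "HS_integral ?G"
    show "eisenstein_integral ?G"
      unfolding eisenstein_integral_def
    proof (intro allI impI)
      fix vs a assume vs: "vertex_enum ?G vs" and "eigenvalue (adjacency_mat ?G vs) a"
      then obtain x where "\<exists>v\<in>V. x v \<noteq> 0" "\<forall>u\<in>V. apply_on V f x u = a * x u"
        unfolding adjacency_mat_def f_def[symmetric] ev_iff[OF vs] by blast
      then obtain y where nz: "\<exists>v\<in>V. y v \<noteq> 0" and ev: "\<forall>u\<in>V. apply_on V f y u = a * y u"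
        and ev_t: "\<forall>u\<in>V. apply_on V (\<lambda>u v. f v u) y u = cnj a * y u"
        using normal_eigenfunction[OF fin real normal] by blast
      have h_int: "k \<in> \<int>" if "\<exists>v\<in>V. x v \<noteq> 0" "\<forall>u\<in>V. apply_on V h x u = k * x u" for k x
        using hs vs that ev_iff[OF vs, of h k]
        by (auto simp: HS_integral_def hermitian_adjacency_mat_def h_def)
      have "\<zeta>\<^sub>6 * a + cnj \<zeta>\<^sub>6 * cnj a \<in> \<int>"
        using nz ev ev_t
        by (intro h_int[of y]) (auto simp: h apply_on_linear_combination algebra_simps)
      moreover have "\<zeta>\<^sub>6 * cnj a + cnj \<zeta>\<^sub>6 * a \<in> \<int>"
      \<comment> \<open>Because \<open>f\<close> is real, conjugating \<open>y\<close> swaps the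
        eigenvalues \<open>a\<close> and \<open>cnj a\<close> of \<open>f\<close> and its transpose.
        This realises the second integer.\<close>
      proof (rule h_int[of "\<lambda>v. cnj (y v)"])
        show "\<exists>v\<in>V. cnj (y v) \<noteq> 0"
          using nz by simp
        have "apply_on V f (\<lambda>v. cnj (y v)) u = cnj (apply_on V f y u)"
          "apply_on V (\<lambda>u v. f v u) (\<lambda>v. cnj (y v)) u = cnj (apply_on V (\<lambda>u v. f v u) y u)" for u
          by (simp_all add: apply_on_def real)
        then show "\<forall>u\<in>V. apply_on V h (\<lambda>v. cnj (y v)) u = (\<zeta>\<^sub>6 * cnj a + cnj \<zeta>\<^sub>6 * a) * cnj (y u)"
          using ev ev_t by (simp add: h apply_on_linear_combination algebra_simps)
      qed
      moreover have "algebraic_int (a * cnj a)"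
      proof (rule algebraic_int_eigenvalue)
        define e where "e u v = (if (u, v) \<in> parcs ?G then 1 else 0 :: int)" for u v
        \<comment> \<open>\<open>M\<close> is the adjacency matrix times its transpose, over the
          integers, and \<open>g\<close> is its complex form. On \<open>y\<close> the transpose acts
          as \<open>cnj a\<close> and then \<open>f\<close> as \<open>a\<close>.\<close>
        define M where "M = mat (length vs) (length vs) (\<lambda>(i, j). \<Sum>v\<in>V. e (vs ! i) v * e (vs ! j) v)"
        define g where "g u w = (\<Sum>v\<in>V. f u v * f w v)" for u w
        show "M \<in> carrier_mat (length vs) (length vs)"
          by (simp add: M_def)
        have "f u v = of_int (e u v)" for u v
          by (simp add: f_def adj_entry_def e_def)
        then have M_eq: "map_mat of_int M = vertex_mat vs g"
          by (auto simp: M_def vertex_mat_def g_def intro!: eq_matI)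
        have "apply_on V g y u = a * cnj a * y u" if "u \<in> V" for u
        proof -
          have "apply_on V g y u = apply_on V f (apply_on V (\<lambda>u v. f v u) y) u"
            unfolding apply_on_def g_def sum_distrib_left sum_distrib_right
            by (subst sum.swap) (simp add: mult_ac)
          also have "\<dots> = cnj a * apply_on V f y u"
            using ev_t by (rule apply_on_scale)
          finally show ?thesis
            using ev that by simp
        qed
        then show "eigenvalue (map_mat of_int M) (a * cnj a)"
          unfolding M_eq ev_iff[OF vs] using nz by blast
      qed
      ultimately show "a \<in> eisenstein_integers"
        by (rule int_imp_eisenstein)
    qed
  qed
qed

end
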